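(* Let $M=\langle W,\{\sim_i,\mathscr{A}_i\}_{i\in\mathcal{G}},V\rangle$ be an epistemic model with awareness such that $\mathscr{A}_i(w)=\mathscr{A}_i(v)$ for every $i\in\mathcal{G}$ and all $w,v\in W$. Let $t^{M\to}(M)$ be its HMS-transform and let $w\in W$. Then for every $\varphi\in\mathcal{L}^*_{AIL}(\mathcal{P},\mathcal{G})$ that satisfies the A-condition at $w$: $$M,w\vDash_{AIL^*}\varphi\iff t^{M\to}(M),[w]_{At(\varphi)}\vDash_{HMS}t(\varphi).$$
   Context: $\mathcal{P}$ is a countable set of atomic propositions and $\mathcal{G}$ a finite set of agents. Languages. - $\mathcal{L}_{PL}(\mathcal{P})$ is the set of propositional formulae $\varphi::=p\mid\neg\varphi\mid\varphi\wedge\varphi$ with $p\in\mathcal{P}$. - $At(\varphi)$ denotes the set of atoms occurring in $\varphi$. - $\mathcal{L}^*_{AIL}(\mathcal{P},\mathcal{G})$ consists of the formulae $\varphi$, $A_i\varphi$ and $[\approx]_iI_i[\approx]_i\varphi$, with $\varphi\in\mathcal{L}_{PL}(\mathcal{P})$ and $i\in\mathcal{G}$. - $\mathcal{L}^*_{HMS}(\mathcal{P},\mathcal{G})$ consists of the formulae $\varphi$, $A_i\varphi$ and $I_i\varphi$, with $\varphi\in\mathcal{L}_{PL}(\mathcal{P})$ and $i\in\mathcal{G}$. - $At(A_i\varphi)=At(I_i\varphi)=At([\approx]_iI_i[\approx]_i\varphi)=At(\varphi)$. Translation. $t:\mathcal{L}^*_{AIL}\to\mathcal{L}^*_{HMS}$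 is given by: - $t(p)=p$, $t(\neg\varphi)=\neg t(\varphi)$ and $t(\varphi\wedge\psi)=t(\varphi)\wedge t(\psi)$; - $t(A_i\varphi)=A_i t(\varphi)$; - $t([\approx]_iI_i[\approx]_i\varphi)=I_i t(\varphi)$. A-condition. A formula $\varphi\in\mathcal{L}^*_{AIL}$ satisfies the A-condition at $w$ iff, whenever $\varphi$ is of the form $A_i\psi$ or $[\approx]_iI_i[\approx]_i\psi$, we have $At(\psi)=\mathscr{A}_i(w)$. AIL models. An epistemic model with awareness is $M=\langle W,\{\sim_i,\mathscr{A}_i\}_{i\in\mathcal{G}},V\rangle$, where: - $W$ is a nonempty set; - each $\sim_i$ is an equivalence relation on $W$; - $\mathscr{A}_i:W\to2^{\mathcal{P}}$ satisfies $\mathscr{A}_i(w)=\mathscr{A}_i(v)$ whenever $w\sim_i v$; - $V:\mathcal{P}\to2^W$ is a valuation. The A-equivalence relation $\approx_i$ is defined by: $w\approx_i v$ iff $\mathscr{A}_i(w)=\mathscr{A}_i(v)$ and, for every $p\in\mathscr{A}_i(w)$, $w\in V(p)\Leftrightarrow v\in V(p)$. AIL satisfaction $\vDash_{AIL^*}$: - Atoms, $\neg$ and $\wedge$ are interpreted classically via $V$. - $M,w\vDash A_i\varphi$ iff $At(\varphi)\subseteq\mathscr{A}_i(w)$. - $M,w\vDash[\approx]_iI_i[\approx]_i\varphi$ iff $M,v\vDash\varphi$ for all $v$ with $w\approx_i u\sim_i u'\approx_i v$ for some $u,u'\in W$. HMS-transform. For $\Phi\subseteq\mathcal{P}$, let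 $w\approx_\Phi v$ iff, for every $p\in\Phi$, $w\in V(p)\Leftrightarrow v\in V(p)$. - $W_\Phi:=W/\approx_\Phi$. The spaces $W_\Phi$ for different $\Phi$ are regarded as pairwise disjoint, with each class tagged by its index $\Phi$. - $[w]_\Phi$ is the class of $w$ in $W_\Phi$, and $W^*:=\bigcup_{\Phi\subseteq\mathcal{P}}W_\Phi$. - For $\Psi\subseteq\Phi$, $m^\Phi_\Psi([w]_\Phi)=[w]_\Psi$. - $\Lambda^*_i:W^*\to2^{W^*}\setminus\{\emptyset\}$ is defined as follows. For $\Phi=\mathcal{P}$: $[v]_{\mathcal{P}}\in\Lambda^*_i([w]_{\mathcal{P}})$ iff $w'\sim_i v'$ for some $w'\in[w]_{\mathcal{P}}$ and $v'\in[v]_{\mathcal{P}}$. Otherwise: $\Lambda^*_i([w]_\Phi)=\{m^{\mathcal{P}}_\Phi(w^* )\mid w^*\in\Lambda^*_i([w]_{\mathcal{P}})\}$. - $\alpha^*_i([w]_\Upsilon)=W_{\mathscr{A}_i(w)\cap\Upsilon}$. - $v^*(p)=\bigcup_{\{p\}\subseteq\Phi\subseteq\mathcal{P}}\{[w]_\Phi\mid w\in V(p)\}$. - Write $W_\Psi\le W_\Phi$ iff $\Psi\subseteq\Phi$. HMS satisfaction. Let $\|\varphi\|:=\{w^*\in W^*\mid t^{M\to}(M),w^*\vDash_{HMS}\varphi\}$, where: - $w^*\vDash p$ iff $w^*\in v^*(p)$; - $w^*\vDash\neg\varphi$ iff $w^*\in\neg\|\varphi\|:=\{u^*\in W_\Phi\mid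 At(\varphi)\subseteq\Phi\subseteq\mathcal{P},\ u^*\notin\|\varphi\|\}$; - $w^*\vDash\varphi\wedge\psi$ iff $w^*\in\|\varphi\|\cap\|\psi\|$; - $w^*\vDash A_i\varphi$ iff $w^*\in e_{A_i}(\|\varphi\|):=\{u^*\mid W_{At(\varphi)}\le\alpha^*_i(u^* )\}$; - $w^*\vDash I_i\varphi$ iff $w^*\in e_{I_i}(\|\varphi\|):=\{u^*\mid\Lambda^*_i(u^* )\subseteq\|\varphi\|\}$.
   Formalization: For Φ ≠ 𝒫 the given formula for Λ*_i([w]_Φ) depends on the chosen representative w, so it is not well defined; here Λ*_i([w]_Φ) is the union of the sets {m(w* ) | w* ∈ Λ*_i([w']_𝒫)} over all w' in [w]_Φ. *)

theory Defs
  imports "HOL-Library.Countable_Set"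
begin

datatype 'p pl = Atom 'p | Neg "'p pl" | Conj "'p pl" "'p pl"

primrec at_pl :: "'p pl \<Rightarrow> 'p set" where
  "at_pl (Atom p) = {p}"
| "at_pl (Neg \<phi>) = at_pl \<phi>"
| "at_pl (Conj \<phi> \<psi>) = at_pl \<phi> \<union> at_pl \<psi>"

definition L_PL :: "'p set \<Rightarrow> 'p pl set" where
  "L_PL P = {\<phi>. at_pl \<phi> \<subseteq> P}"

text \<open>In \<open>ail\<close>, the constructor \<open>ExplK i \<phi>\<close> is the formula \<open>[\<approx>]\<^sub>i I\<^sub>i [\<approx>]\<^sub>i \<phi>\<close>.
  The modalities are not nested: their arguments are propositional.\<close>

datatype ('p, 'g) ail = AProp "'p pl" | AAware 'g "'p pl" | ExplK 'g "'p pl"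

datatype ('p, 'g) hml = HProp "'p pl" | HAware 'g "'p pl" | HKnow 'g "'p pl"

primrec at_ail :: "('p, 'g) ail \<Rightarrow> 'p set" where
  "at_ail (AProp \<phi>) = at_pl \<phi>"
| "at_ail (AAware i \<phi>) = at_pl \<phi>"
| "at_ail (ExplK i \<phi>) = at_pl \<phi>"

definition L_AIL :: "'p set \<Rightarrow> 'g set \<Rightarrow> ('p, 'g) ail set" where
  "L_AIL P G = AProp ` L_PL P
     \<union> {AAware i \<phi> | i \<phi>. i \<in> G \<and> \<phi> \<in> L_PL P}
     \<union> {ExplK i \<phi> | i \<phi>. i \<in> G \<and> \<phi> \<in> L_PL P}"

primrec trans_pl :: "'p pl \<Rightarrow> 'p pl" where
  "trans_pl (Atom p) = Atom p"
| "trans_pl (Neg \<phi>) = Neg (trans_pl \<phi>)"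
| "trans_pl (Conj \<phi> \<psi>) = Conj (trans_pl \<phi>) (trans_pl \<psi>)"

primrec trans_ail :: "('p, 'g) ail \<Rightarrow> ('p, 'g) hml" where
  "trans_ail (AProp \<phi>) = HProp (trans_pl \<phi>)"
| "trans_ail (AAware i \<phi>) = HAware i (trans_pl \<phi>)"
| "trans_ail (ExplK i \<phi>) = HKnow i (trans_pl \<phi>)"


subsection \<open>Epistemic models with awareness\<close>

record ('w, 'p, 'g) ail_model =
  worlds :: "'w set"
  indist :: "'g \<Rightarrow> ('w \<times> 'w) set"
  aware  :: "'g \<Rightarrow> 'w \<Rightarrow> 'p set"
  valu   :: "'p \<Rightarrow> 'w set"

definition epistemic_model_with_awareness ::
    "'p set \<Rightarrow> 'g set \<Rightarrow> ('w, 'p, 'g) ail_model \<Rightarrow> bool" where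
  "epistemic_model_with_awareness P G M \<longleftrightarrow>
     worlds M \<noteq> {} \<and>
     (\<forall>i\<in>G. equiv (worlds M) (indist M i)) \<and>
     (\<forall>i\<in>G. \<forall>w\<in>worlds M. aware M i w \<subseteq> P) \<and>
     (\<forall>i\<in>G. \<forall>(w, v)\<in>indist M i. aware M i w = aware M i v) \<and>
     (\<forall>p\<in>P. valu M p \<subseteq> worlds M)"

definition A_equiv :: "('w, 'p, 'g) ail_model \<Rightarrow> 'g \<Rightarrow> ('w \<times> 'w) set" where
  "A_equiv M i = {(w, v). w \<in> worlds M \<and> v \<in> worlds M \<and> aware M i w = aware M i v \<and>
     (\<forall>p\<in>aware M i w. w \<in> valu M p \<longleftrightarrow> v \<in> valu M p)}"

primrec pl_sat :: "('w, 'p, 'g) ail_model \<Rightarrow> 'w \<Rightarrow> 'p pl \<Rightarrow> bool" where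
  "pl_sat M w (Atom p) \<longleftrightarrow> w \<in> valu M p"
| "pl_sat M w (Neg \<phi>) \<longleftrightarrow> \<not> pl_sat M w \<phi>"
| "pl_sat M w (Conj \<phi> \<psi>) \<longleftrightarrow> pl_sat M w \<phi> \<and> pl_sat M w \<psi>"

primrec ail_sat :: "('w, 'p, 'g) ail_model \<Rightarrow> 'w \<Rightarrow> ('p, 'g) ail \<Rightarrow> bool" where
  "ail_sat M w (AProp \<phi>) \<longleftrightarrow> pl_sat M w \<phi>"
| "ail_sat M w (AAware i \<phi>) \<longleftrightarrow> at_pl \<phi> \<subseteq> aware M i w"
| "ail_sat M w (ExplK i \<phi>) \<longleftrightarrow>
     (\<forall>v. (w, v) \<in> A_equiv M i O indist M i O A_equiv M i \<longrightarrow> pl_sat M v \<phi>)"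

primrec A_condition :: "('w, 'p, 'g) ail_model \<Rightarrow> 'w \<Rightarrow> ('p, 'g) ail \<Rightarrow> bool" where
  "A_condition M w (AProp \<phi>) \<longleftrightarrow> True"
| "A_condition M w (AAware i \<phi>) \<longleftrightarrow> at_pl \<phi> = aware M i w"
| "A_condition M w (ExplK i \<phi>) \<longleftrightarrow> at_pl \<phi> = aware M i w"


subsection \<open>HMS satisfaction\<close>

text \<open>The data interpreting HMS formulae: the space \<open>W\<^sub>\<Phi>\<close> for each vocabulary \<open>\<Phi>\<close>, the order on
  spaces, the projections (\<open>hms_proj H \<Phi> \<Psi>\<close> goes from \<open>W\<^sub>\<Phi>\<close> to \<open>W\<^sub>\<Psi>\<close>), the possibility
  correspondences \<open>\<Lambda>\<^sub>i\<close>, the awareness functions \<open>\<alpha>\<^sub>i\<close> and the valuation.\<close>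

record ('x, 'p, 'g) hms =
  hms_space :: "'p set \<Rightarrow> 'x set"
  hms_le    :: "'x set \<Rightarrow> 'x set \<Rightarrow> bool"
  hms_proj  :: "'p set \<Rightarrow> 'p set \<Rightarrow> 'x \<Rightarrow> 'x"
  hms_poss  :: "'g \<Rightarrow> 'x \<Rightarrow> 'x set"
  hms_aware :: "'g \<Rightarrow> 'x \<Rightarrow> 'x set"
  hms_valu  :: "'p \<Rightarrow> 'x set"

definition hms_states :: "'p set \<Rightarrow> ('x, 'p, 'g) hms \<Rightarrow> 'x set" where
  "hms_states P H = (\<Union>\<Phi>\<in>Pow P. hms_space H \<Phi>)"

text \<open>Negation and awareness of an event \<open>\<parallel>\<phi>\<parallel>\<close> also depend on \<open>At(\<phi>)\<close>, here the set \<open>X\<close>.\<close>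

definition hms_neg :: "'p set \<Rightarrow> ('x, 'p, 'g) hms \<Rightarrow> 'p set \<Rightarrow> 'x set \<Rightarrow> 'x set" where
  "hms_neg P H X E = {u. \<exists>\<Phi>. X \<subseteq> \<Phi> \<and> \<Phi> \<subseteq> P \<and> u \<in> hms_space H \<Phi> \<and> u \<notin> E}"

definition hms_eA :: "'p set \<Rightarrow> ('x, 'p, 'g) hms \<Rightarrow> 'g \<Rightarrow> 'p set \<Rightarrow> 'x set" where
  "hms_eA P H i X = {u \<in> hms_states P H. hms_le H (hms_space H X) (hms_aware H i u)}"

definition hms_eI :: "'p set \<Rightarrow> ('x, 'p, 'g) hms \<Rightarrow> 'g \<Rightarrow> 'x set \<Rightarrow> 'x set" where
  "hms_eI P H i E = {u \<in> hms_states P H. hms_poss H i u \<subseteq> E}"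

primrec hms_pl_sat :: "'p set \<Rightarrow> ('x, 'p, 'g) hms \<Rightarrow> 'p pl \<Rightarrow> 'x \<Rightarrow> bool" where
  "hms_pl_sat P H (Atom p) u \<longleftrightarrow> u \<in> hms_valu H p"
| "hms_pl_sat P H (Neg \<phi>) u \<longleftrightarrow>
     u \<in> hms_neg P H (at_pl \<phi>) {x \<in> hms_states P H. hms_pl_sat P H \<phi> x}"
| "hms_pl_sat P H (Conj \<phi> \<psi>) u \<longleftrightarrow>
     u \<in> {x \<in> hms_states P H. hms_pl_sat P H \<phi> x} \<inter> {x \<in> hms_states P H. hms_pl_sat P H \<psi> x}"

primrec hms_sat :: "'p set \<Rightarrow> ('x, 'p, 'g) hms \<Rightarrow> 'x \<Rightarrow> ('p, 'g) hml \<Rightarrow> bool" where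
  "hms_sat P H u (HProp \<phi>) \<longleftrightarrow> hms_pl_sat P H \<phi> u"
| "hms_sat P H u (HAware i \<phi>) \<longleftrightarrow> u \<in> hms_eA P H i (at_pl \<phi>)"
| "hms_sat P H u (HKnow i \<phi>) \<longleftrightarrow> u \<in> hms_eI P H i {x \<in> hms_states P H. hms_pl_sat P H \<phi> x}"


subsection \<open>The HMS-transform\<close>

text \<open>A state of \<open>W\<^sup>*\<close> is a pair of a vocabulary \<open>\<Phi>\<close> and an equivalence class of \<open>\<approx>\<^sub>\<Phi>\<close>; the tag
  \<open>\<Phi>\<close> makes the spaces pairwise disjoint.\<close>

type_synonym ('w, 'p) tstate = "'p set \<times> 'w set"

definition voc_equiv :: "('w, 'p, 'g) ail_model \<Rightarrow> 'p set \<Rightarrow> ('w \<times> 'w) set" where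
  "voc_equiv M \<Phi> = {(w, v). w \<in> worlds M \<and> v \<in> worlds M \<and>
     (\<forall>p\<in>\<Phi>. w \<in> valu M p \<longleftrightarrow> v \<in> valu M p)}"

definition cls :: "('w, 'p, 'g) ail_model \<Rightarrow> 'p set \<Rightarrow> 'w \<Rightarrow> ('w, 'p) tstate" where
  "cls M \<Phi> w = (\<Phi>, voc_equiv M \<Phi> `` {w})"

definition tspace :: "('w, 'p, 'g) ail_model \<Rightarrow> 'p set \<Rightarrow> ('w, 'p) tstate set" where
  "tspace M \<Phi> = Pair \<Phi> ` (worlds M // voc_equiv M \<Phi>)"

definition tle :: "'p set \<Rightarrow> ('w, 'p, 'g) ail_model \<Rightarrow>
    ('w, 'p) tstate set \<Rightarrow> ('w, 'p) tstate set \<Rightarrow> bool" where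
  "tle P M X Y \<longleftrightarrow>
     (\<exists>\<Psi> \<Phi>. \<Psi> \<subseteq> P \<and> \<Phi> \<subseteq> P \<and> X = tspace M \<Psi> \<and> Y = tspace M \<Phi> \<and> \<Psi> \<subseteq> \<Phi>)"

text \<open>\<open>m\<^sup>\<Phi>\<^sub>\<Psi>([w]\<^sub>\<Phi>) = [w]\<^sub>\<Psi>\<close>; the description is unique when \<open>\<Psi> \<subseteq> \<Phi>\<close>.\<close>

definition tproj :: "('w, 'p, 'g) ail_model \<Rightarrow> 'p set \<Rightarrow> 'p set \<Rightarrow>
    ('w, 'p) tstate \<Rightarrow> ('w, 'p) tstate" where
  "tproj M \<Phi> \<Psi> x = (THE y. \<exists>w\<in>worlds M. x = cls M \<Phi> w \<and> y = cls M \<Psi> w)"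

definition tposs_top :: "'p set \<Rightarrow> ('w, 'p, 'g) ail_model \<Rightarrow> 'g \<Rightarrow>
    ('w, 'p) tstate \<Rightarrow> ('w, 'p) tstate set" where
  "tposs_top P M i x = {cls M P v | v. v \<in> worlds M \<and>
     (\<exists>w'\<in>snd x. \<exists>v'\<in>snd (cls M P v). (w', v') \<in> indist M i)}"

text \<open>Below the top space, \<open>{m(y) | y \<in> \<Lambda>([w]\<^sub>P)}\<close> depends on the world \<open>w\<close> representing the class
  \<open>[w]\<^sub>\<Phi>\<close>, because worlds that agree on \<open>\<Phi>\<close> may disagree on \<open>P\<close>. The value at a class collects the
  contributions of all its representatives.\<close>

definition tposs :: "'p set \<Rightarrow> ('w, 'p, 'g) ail_model \<Rightarrow> 'g \<Rightarrow>
    ('w, 'p) tstate \<Rightarrow> ('w, 'p) tstate set" where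
  "tposs P M i x =
     (if fst x = P then tposs_top P M i x
      else (\<Union>w\<in>snd x. tproj M P (fst x) ` tposs_top P M i (cls M P w)))"

text \<open>\<open>\<alpha>\<^sub>i([w]\<^sub>\<Upsilon>) = W\<^bsub>A\<^sub>i(w) \<inter> \<Upsilon>\<^esub>\<close>; the description is unique if \<open>A\<^sub>i\<close> is constant on \<open>W\<close>.\<close>

definition taware :: "('w, 'p, 'g) ail_model \<Rightarrow> 'g \<Rightarrow>
    ('w, 'p) tstate \<Rightarrow> ('w, 'p) tstate set" where
  "taware M i x = (THE S. \<exists>w\<in>snd x. S = tspace M (aware M i w \<inter> fst x))"

definition tvalu :: "'p set \<Rightarrow> ('w, 'p, 'g) ail_model \<Rightarrow> 'p \<Rightarrow> ('w, 'p) tstate set" where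
  "tvalu P M p = (\<Union>\<Phi>\<in>{\<Phi>. {p} \<subseteq> \<Phi> \<and> \<Phi> \<subseteq> P}. {cls M \<Phi> w | w. w \<in> valu M p})"

definition hms_transform :: "'p set \<Rightarrow> ('w, 'p, 'g) ail_model \<Rightarrow>
    (('w, 'p) tstate, 'p, 'g) hms" where
  "hms_transform P M =
     \<lparr> hms_space = tspace M,
       hms_le = tle P M,
       hms_proj = tproj M,
       hms_poss = tposs P M,
       hms_aware = taware M,
       hms_valu = tvalu P M \<rparr>"

end

theory Submission imports Defs begin

text \<open>A class \<open>[w]\<^sub>\<Phi>\<close> with \<open>At(\<phi>) \<subseteq> \<Phi>\<close> decides a propositional \<open>\<phi>\<close> exactly as \<open>w\<close> does. If awareness
  is constant and \<open>\<A>\<^sub>i(w) = \<Phi>\<close>, then \<open>\<approx>\<^sub>i\<close> is \<open>\<approx>\<^sub>\<Phi>\<close>, and \<open>\<Lambda>\<^sup>*\<^sub>i([w]\<^sub>\<Phi>)\<close> consists of the classes of the worlds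
  reachable from \<open>w\<close> along \<open>\<approx>\<^sub>\<Phi> ; \<sim>\<^sub>i ; \<approx>\<^sub>\<Phi>\<close>: the two steps along \<open>\<approx>\<^sub>P\<close> in the definition of \<open>\<Lambda>\<^sup>*\<^sub>i\<close>
  are absorbed because \<open>\<approx>\<^sub>P\<close> refines \<open>\<approx>\<^sub>\<Phi>\<close>.\<close>

lemma trans_pl_id [simp]: "trans_pl \<phi> = \<phi>"
  by (induction \<phi>) auto

lemma equiv_voc_equiv: "equiv (worlds M) (voc_equiv M \<Phi>)"
  by (auto simp: voc_equiv_def intro!: equivI refl_onI symI transI)

lemma voc_equiv_mono: "\<Psi> \<subseteq> \<Phi> \<Longrightarrow> voc_equiv M \<Phi> \<subseteq> voc_equiv M \<Psi>"
  by (auto simp: voc_equiv_def)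

lemma voc_equiv_trans:
  "(u, v) \<in> voc_equiv M \<Phi> \<Longrightarrow> (v, w) \<in> voc_equiv M \<Phi> \<Longrightarrow> (u, w) \<in> voc_equiv M \<Phi>"
  by (auto simp: voc_equiv_def)

lemma voc_equiv_sym: "(u, v) \<in> voc_equiv M \<Phi> \<longleftrightarrow> (v, u) \<in> voc_equiv M \<Phi>"
  by (auto simp: voc_equiv_def)

lemma fst_cls [simp]: "fst (cls M \<Phi> w) = \<Phi>"
  by (simp add: cls_def)

lemma mem_snd_cls [simp]: "v \<in> snd (cls M \<Phi> w) \<longleftrightarrow> (w, v) \<in> voc_equiv M \<Phi>"
  by (simp add: cls_def)

lemma cls_eq_iff:
  assumes "w \<in> worlds M" "v \<in> worlds M"
  shows "cls M \<Phi> w = cls M \<Phi> v \<longleftrightarrow> (w, v) \<in> voc_equiv M \<Phi>"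
  using eq_equiv_class_iff[OF equiv_voc_equiv assms] by (simp add: cls_def)

lemma cls_in_tspace_iff:
  assumes "w \<in> worlds M"
  shows "cls M \<Phi> w \<in> tspace M \<Psi> \<longleftrightarrow> \<Phi> = \<Psi>"
  using assms by (auto simp: cls_def tspace_def quotient_def)

lemma cls_in_states:
  assumes "w \<in> worlds M" "\<Phi> \<subseteq> P"
  shows "cls M \<Phi> w \<in> hms_states P (hms_transform P M)"
  using assms by (auto simp: hms_states_def hms_transform_def cls_in_tspace_iff)

text \<open>\<open>tvalu\<close> ranges over all vocabularies containing \<open>p\<close>, but the
  tag forces the vocabulary to be \<open>\<Phi>\<close>. Since \<open>p\<close> is in
  \<open>\<Phi>\<close>, the whole class then agrees on \<open>p\<close>.\<close>

lemma cls_in_tvalu_iff: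
  assumes "valu M p \<subseteq> worlds M" "w \<in> worlds M" "p \<in> \<Phi>" "\<Phi> \<subseteq> P"
  shows "cls M \<Phi> w \<in> tvalu P M p \<longleftrightarrow> w \<in> valu M p"
proof
  assume "cls M \<Phi> w \<in> tvalu P M p"
  then obtain \<Psi> v where v: "v \<in> valu M p" and eq: "cls M \<Phi> w = cls M \<Psi> v"
    by (auto simp: tvalu_def)
  have "\<Psi> = \<Phi>" using arg_cong[OF eq, of fst] by simp
  with eq v assms have "(w, v) \<in> voc_equiv M \<Phi>" by (auto simp: cls_eq_iff)
  with v assms show "w \<in> valu M p" by (auto simp: voc_equiv_def)
qed (use assms in \<open>auto simp: tvalu_def\<close>)

text \<open>The vocabulary \<open>\<Phi>\<close> is kept separate from \<open>at_pl \<phi>\<close>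
  and fixed in the induction, because subformulas may have fewer atoms.\<close>

lemma hms_pl_sat_cls_iff:
  assumes "\<forall>p\<in>P. valu M p \<subseteq> worlds M" "w \<in> worlds M" "at_pl \<phi> \<subseteq> \<Phi>" "\<Phi> \<subseteq> P"
  shows "hms_pl_sat P (hms_transform P M) \<phi> (cls M \<Phi> w) \<longleftrightarrow> pl_sat M w \<phi>"
  using assms(3)
proof (induction \<phi>)
  case (Atom p)
  then show ?case
    using assms cls_in_tvalu_iff[of M p w \<Phi> P] by (auto simp: hms_transform_def)
next
  case (Neg \<phi>)
  \<comment> \<open>The tag leaves \<open>\<Phi>\<close> as the only witness in
    \<open>hms_neg\<close>, and it contains the atoms of the negated formula, so negation is
    classical at this state.\<close>
  have "hms_space (hms_transform P M) = tspace M" by (simp add: hms_transform_def)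
  with Neg assms show ?case
    by (simp add: hms_neg_def cls_in_tspace_iff cls_in_states)
next
  case (Conj \<phi> \<psi>)
  with assms show ?case by (simp add: cls_in_states)
qed

text \<open>Every representative of a class over \<open>\<Phi>\<close> yields the same class over
  \<open>\<Psi>\<close>, because agreement on \<open>\<Phi>\<close> implies agreement on
  \<open>\<Psi>\<close>. Hence the description in \<open>tproj\<close> is unique.\<close>

lemma tproj_cls:
  assumes "w \<in> worlds M" "\<Psi> \<subseteq> \<Phi>"
  shows "tproj M \<Phi> \<Psi> (cls M \<Phi> w) = cls M \<Psi> w"
  unfolding tproj_def
proof (rule the_equality)
  fix y assume "\<exists>v\<in>worlds M. cls M \<Phi> w = cls M \<Phi> v \<and> y = cls M \<Psi> v"
  then show "y = cls M \<Psi> w"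
    using assms(1) voc_equiv_mono[OF assms(2), of M] by (auto simp: cls_eq_iff voc_equiv_sym[of w])
qed (use assms in blast)

lemma tposs_top_cls:
  "tposs_top P M i (cls M P w) =
    {cls M P v | v. (w, v) \<in> voc_equiv M P O indist M i O voc_equiv M P}"
proof -
  have "v \<in> worlds M \<and> (\<exists>w'\<in>snd (cls M P w). \<exists>v'\<in>snd (cls M P v). (w', v') \<in> indist M i) \<longleftrightarrow>
      (w, v) \<in> voc_equiv M P O indist M i O voc_equiv M P" for v
  proof -
    have "v \<in> worlds M" if "(v', v) \<in> voc_equiv M P" for v'
      using that by (simp add: voc_equiv_def)
    then show ?thesis unfolding Bex_def mem_snd_cls voc_equiv_sym[of v] by blast
  qed
  then show ?thesis unfolding tposs_top_def by simp
qed

lemma tposs_cls: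
  assumes "w \<in> worlds M" "\<Phi> \<subseteq> P"
  shows "tposs P M i (cls M \<Phi> w) =
    {cls M \<Phi> v | v. (w, v) \<in> voc_equiv M \<Phi> O indist M i O voc_equiv M \<Phi>}"
proof (cases "\<Phi> = P")
  case True
  then show ?thesis by (simp add: tposs_def tposs_top_cls)
next
  case False
  let ?E = "voc_equiv M \<Phi>" and ?T = "voc_equiv M P"
  have in_worlds: "v \<in> worlds M" if "(u, v) \<in> voc_equiv M \<Psi>" for u v \<Psi>
    using that by (simp add: voc_equiv_def)
  have T_E: "?T \<subseteq> ?E" by (rule voc_equiv_mono[OF assms(2)])
  have proj: "tproj M P \<Phi> ` tposs_top P M i (cls M P u) =
      {cls M \<Phi> v | v. (u, v) \<in> ?T O indist M i O ?T}" for u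
  proof -
    have "tproj M P \<Phi> (cls M P v) = cls M \<Phi> v" if "(u, v) \<in> ?T O indist M i O ?T" for v
      using that by (intro tproj_cls assms) (auto dest: in_worlds)
    then show ?thesis unfolding tposs_top_cls setcompr_eq_image image_image
      by (intro image_cong) simp_all
  qed
  \<comment> \<open>The union over the representatives \<open>u\<close> of the class becomes a first
    step from \<open>w\<close> to \<open>u\<close> along \<open>?E\<close>.\<close>
  have lhs: "tposs P M i (cls M \<Phi> w) =
      {cls M \<Phi> v | u v. (w, u) \<in> ?E \<and> (u, v) \<in> ?T O indist M i O ?T}"
    using False unfolding tposs_def fst_cls proj by (simp add: Bex_def set_eq_iff) blast
  show ?thesis unfolding lhs
  proof (intro set_eqI iffI)
    fix x assume "x \<in> {cls M \<Phi> v | u v. (w, u) \<in> ?E \<and> (u, v) \<in> ?T O indist M i O ?T}"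
    then obtain u v a b where *: "x = cls M \<Phi> v" "(w, u) \<in> ?E" "(u, a) \<in> ?T"
      "(a, b) \<in> indist M i" "(b, v) \<in> ?T" by auto
    have "(w, a) \<in> ?E" using * T_E by (blast intro: voc_equiv_trans)
    with * T_E show "x \<in> {cls M \<Phi> v | v. (w, v) \<in> ?E O indist M i O ?E}" by blast
  next
    fix x assume "x \<in> {cls M \<Phi> v | v. (w, v) \<in> ?E O indist M i O ?E}"
    then obtain v a b where *: "x = cls M \<Phi> v" "(w, a) \<in> ?E"
      "(a, b) \<in> indist M i" "(b, v) \<in> ?E" by auto
    \<comment> \<open>The representative \<open>u\<close> is chosen to be \<open>a\<close>, and
      \<open>x\<close> is rewritten as the class of \<open>b\<close>. Both \<open>?T\<close> steps
      are then reflexive.\<close>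
    have b: "b \<in> worlds M" using *(4) by (simp add: voc_equiv_def)
    have "x = cls M \<Phi> b" using *(1,4) b in_worlds by (metis cls_eq_iff)
    moreover have "(a, a) \<in> ?T" "(b, b) \<in> ?T" using * b by (auto simp: voc_equiv_def)
    ultimately show "x \<in> {cls M \<Phi> v | u v. (w, u) \<in> ?E \<and> (u, v) \<in> ?T O indist M i O ?T}"
      using * by blast
  qed
qed

text \<open>With constant awareness all representatives name the same space, and \<open>w\<close>
  itself shows that there is one.\<close>

lemma taware_cls:
  assumes "w \<in> worlds M" "\<forall>v\<in>worlds M. aware M i v = \<Psi>"
  shows "taware M i (cls M \<Phi> w) = tspace M (\<Psi> \<inter> \<Phi>)"
  unfolding taware_def
proof (rule the_equality)
  have "(w, w) \<in> voc_equiv M \<Phi>" using assms(1) by (simp add: voc_equiv_def)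
  then show "\<exists>v\<in>snd (cls M \<Phi> w). tspace M (\<Psi> \<inter> \<Phi>) = tspace M (aware M i v \<inter> fst (cls M \<Phi> w))"
    using assms by (intro bexI[of _ w]) simp_all
qed (use assms(2) in \<open>auto simp: voc_equiv_def\<close>)

lemma A_equiv_eq_voc_equiv:
  assumes "\<forall>v\<in>worlds M. aware M i v = \<Phi>"
  shows "A_equiv M i = voc_equiv M \<Phi>"
  using assms by (auto simp: A_equiv_def voc_equiv_def)

theorem theorem1:
  fixes P :: "'p set" and G :: "'g set"
    and M :: "('w, 'p, 'g) ail_model" and w :: 'w and \<phi> :: "('p, 'g) ail"
  assumes "countable P" and "finite G"
    and "epistemic_model_with_awareness P G M"
    and "\<forall>i\<in>G. \<forall>w\<in>worlds M. \<forall>v\<in>worlds M. aware M i w = aware M i v"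
    and "w \<in> worlds M"
    and "\<phi> \<in> L_AIL P G"
    and "A_condition M w \<phi>"
  shows "ail_sat M w \<phi> \<longleftrightarrow>
    hms_sat P (hms_transform P M) (cls M (at_ail \<phi>) w) (trans_ail \<phi>)"
proof -
  let ?H = "hms_transform P M"
  have valu: "\<forall>p\<in>P. valu M p \<subseteq> worlds M"
    using assms(3) by (simp add: epistemic_model_with_awareness_def)
  show ?thesis
  proof (cases \<phi>)
    case (AProp \<psi>)
    with assms(6) have "at_pl \<psi> \<subseteq> P" by (auto simp: L_AIL_def L_PL_def)
    with AProp show ?thesis using hms_pl_sat_cls_iff[OF valu assms(5)] by simp
  next
    case (AAware i \<psi>)
    with assms(6) have at: "at_pl \<psi> \<subseteq> P" and i: "i \<in> G" by (auto simp: L_AIL_def L_PL_def)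
    from AAware assms(7) have aw: "at_pl \<psi> = aware M i w" by simp
    \<comment> \<open>The A-condition concerns \<open>w\<close> alone; constancy carries it to all
      worlds. Both sides of the equivalence turn out to be true in this case.\<close>
    have "\<forall>v\<in>worlds M. aware M i v = at_pl \<psi>" using assms(4,5) i aw by blast
    then have "taware M i (cls M (at_pl \<psi>) w) = tspace M (at_pl \<psi>)"
      using taware_cls[OF assms(5), of i "at_pl \<psi>" "at_pl \<psi>"] by simp
    then have "hms_le ?H (hms_space ?H (at_pl \<psi>)) (hms_aware ?H i (cls M (at_pl \<psi>) w))"
      using at by (auto simp: hms_transform_def tle_def)
    with AAware aw at show ?thesis
      by (simp add: hms_eA_def cls_in_states[OF assms(5)])
  next
    case (ExplK i \<psi>)
    let ?E = "voc_equiv M (at_pl \<psi>)"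
    from ExplK assms(6) have at: "at_pl \<psi> \<subseteq> P" and i: "i \<in> G" by (auto simp: L_AIL_def L_PL_def)
    from ExplK assms(7) have aw: "at_pl \<psi> = aware M i w" by simp
    have "\<forall>v\<in>worlds M. aware M i v = at_pl \<psi>" using assms(4,5) i aw by blast
    then have E: "A_equiv M i = ?E" by (rule A_equiv_eq_voc_equiv)
    have poss: "hms_poss ?H i (cls M (at_pl \<psi>) w) =
        {cls M (at_pl \<psi>) v | v. (w, v) \<in> ?E O indist M i O ?E}"
      using tposs_cls[OF assms(5) at] by (simp add: hms_transform_def)
    \<comment> \<open>All states possible at the class of \<open>w\<close> lie in the space of
      \<open>at_pl \<psi>\<close>, so the propositional case applies to each of them without
      changing vocabulary.\<close>
    have "cls M (at_pl \<psi>) v \<in> {x \<in> hms_states P ?H. hms_pl_sat P ?H \<psi> x} \<longleftrightarrow> pl_sat M v \<psi>"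
      if "(w, v) \<in> ?E O indist M i O ?E" for v
    proof -
      have "v \<in> worlds M" using that by (auto simp: voc_equiv_def)
      then show ?thesis
        using at hms_pl_sat_cls_iff[OF valu _ order_refl at] by (simp add: cls_in_states)
    qed
    then have "hms_poss ?H i (cls M (at_pl \<psi>) w) \<subseteq> {x \<in> hms_states P ?H. hms_pl_sat P ?H \<psi> x}
        \<longleftrightarrow> (\<forall>v. (w, v) \<in> ?E O indist M i O ?E \<longrightarrow> pl_sat M v \<psi>)"
      unfolding poss by blast
    with ExplK E show ?thesis
      by (simp add: hms_eI_def cls_in_states[OF assms(5) at])
  qed
qed

end
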